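(* For every set of formulas $\Gamma\cup\{\varphi\}\subseteq \mathbf{F}(\Sigma_{\mathbf{bI}},\mathcal V)$: if $\Gamma\vdash_{\mathbf{bI}}\varphi$ then $\Gamma\Vdash^{\mathbf{bI}}_{\mathcal F}\varphi$.
   Context: Let $\mathcal V$ be a countable set of propositional variables and $\Sigma_{\mathbf{bI}}=\{\vee,\wedge,\rightarrow,\uparrow\}$, all connectives binary; $\mathbf F(\Sigma_{\mathbf{bI}},\mathcal V)$ is the set of formulas. The logic $\mathbf{bI}$ is the Hilbert calculus whose only inference rule is Modus Ponens and whose axioms are all instances (with arbitrary formulas) of: (1) $\alpha\to(\beta\to\alpha)$; (2) $(\alpha\to(\beta\to\gamma))\to((\alpha\to\beta)\to(\alpha\to\gamma))$; (3) $\alpha\to(\beta\to(\alpha\wedge\beta))$; (4) $(\alpha\wedge\beta)\to\alpha$; (5) $(\alpha\wedge\beta)\to\beta$; (6) $\alpha\to(\alpha\vee\beta)$; (7) $\beta\to(\alpha\vee\beta)$; (8) $(\alpha\to\gamma)\to((\beta\to\gamma)\to((\alpha\vee\beta)\to\gamma))$; (9) $(\alpha\to\beta)\vee\alpha$; (Ip) $(\alpha\uparrow\beta)\to(\alpha\to(\beta\to\gamma))$; (Comm) $(\alpha\uparrow\beta)\to(\beta\uparrow\alpha)$. $\Gamma\vdash_{\mathbf{bI}}\varphi$ means that there is a finite derivation of $\varphi$ from premises in $\Gamma$. A $\Sigma$-multialgebra on a nonempty set $A$ interprets each $n$-ary connective $\sigma$ as a function $\sigma_{\mathcal A}:A^n\to\wp(A)\setminus\{\emptyset\}$;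 an operation with only singleton values is identified with an ordinary operation. A valuation over $\mathcal A$ is a map $\nu$ from formulas to $A$ with $\nu(\sigma(\varphi_1,\dots,\varphi_n))\in\sigma_{\mathcal A}(\nu(\varphi_1),\dots,\nu(\varphi_n))$ for all connectives $\sigma$ and formulas $\varphi_i$. An RNmatrix (restricted non-deterministic matrix) for $\mathbf{bI}$ is a triple $(\mathcal A,D,\mathcal F)$ where: - $\mathcal A$ is a $\Sigma_{\mathbf{bI}}$-multialgebra with universe $A$ in which $\wedge,\vee,\to$ are ordinary operations making $A$ a Boolean algebra with bottom $0$ and top $1$ (with $\to$ the Boolean implication), and such that for all $a,b\in A$, $a\uparrow b=b\uparrow a$ (as sets), and for all $a,b,c\in A$, if $c\in a\uparrow b$ then $a\wedge b\wedge c=0$; - $D=\{1\}$ (designated elements; $D$ is a proper subset of $A$, i.e. $0\ne1$); - $\mathcal F$ is the set of all valuations $\nu$ over $\mathcal A$ with $\nu(\alpha\uparrow\beta)=\nu(\beta\uparrow\alpha)$ for all formulas $\alpha,\beta$. $\Gamma\Vdash^{\mathbf{bI}}_{\mathcal F}\varphi$ means: for every RNmatrix $(\mathcal A,D,\mathcal F)$ for $\mathbf{bI}$ and every $\nu\in\mathcal F$, if $\nu(\gamma)\in D$ for all $\gamma\in\Gamma$ then $\nu(\varphi)\in D$. *)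

theory Defs
  imports "HOL-Library.Countable"
begin

section \<open>Formulas\<close>

datatype conn = Or | And | Imp | Up

datatype 'v form = Var 'v | App conn "'v form" "'v form"

abbreviation fdisj :: "'v form \<Rightarrow> 'v form \<Rightarrow> 'v form"  (infixr "\<^bold>\<or>" 65)
  where "\<alpha> \<^bold>\<or> \<beta> \<equiv> App Or \<alpha> \<beta>"

abbreviation fconj :: "'v form \<Rightarrow> 'v form \<Rightarrow> 'v form"  (infixr "\<^bold>\<and>" 70)
  where "\<alpha> \<^bold>\<and> \<beta> \<equiv> App And \<alpha> \<beta>"

abbreviation fimp :: "'v form \<Rightarrow> 'v form \<Rightarrow> 'v form"  (infixr "\<^bold>\<rightarrow>" 60)
  where "\<alpha> \<^bold>\<rightarrow> \<beta> \<equiv> App Imp \<alpha> \<beta>"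

abbreviation fincomp :: "'v form \<Rightarrow> 'v form \<Rightarrow> 'v form"  (infix "\<^bold>\<up>" 75)
  where "\<alpha> \<^bold>\<up> \<beta> \<equiv> App Up \<alpha> \<beta>"


section \<open>The Hilbert calculus bI\<close>

inductive bI_axiom :: "'v form \<Rightarrow> bool" where
  Ax1: "bI_axiom (\<alpha> \<^bold>\<rightarrow> (\<beta> \<^bold>\<rightarrow> \<alpha>))"
| Ax2: "bI_axiom ((\<alpha> \<^bold>\<rightarrow> (\<beta> \<^bold>\<rightarrow> \<gamma>)) \<^bold>\<rightarrow> ((\<alpha> \<^bold>\<rightarrow> \<beta>) \<^bold>\<rightarrow> (\<alpha> \<^bold>\<rightarrow> \<gamma>)))"
| Ax3: "bI_axiom (\<alpha> \<^bold>\<rightarrow> (\<beta> \<^bold>\<rightarrow> (\<alpha> \<^bold>\<and> \<beta>)))"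
| Ax4: "bI_axiom ((\<alpha> \<^bold>\<and> \<beta>) \<^bold>\<rightarrow> \<alpha>)"
| Ax5: "bI_axiom ((\<alpha> \<^bold>\<and> \<beta>) \<^bold>\<rightarrow> \<beta>)"
| Ax6: "bI_axiom (\<alpha> \<^bold>\<rightarrow> (\<alpha> \<^bold>\<or> \<beta>))"
| Ax7: "bI_axiom (\<beta> \<^bold>\<rightarrow> (\<alpha> \<^bold>\<or> \<beta>))"
| Ax8: "bI_axiom ((\<alpha> \<^bold>\<rightarrow> \<gamma>) \<^bold>\<rightarrow> ((\<beta> \<^bold>\<rightarrow> \<gamma>) \<^bold>\<rightarrow> ((\<alpha> \<^bold>\<or> \<beta>) \<^bold>\<rightarrow> \<gamma>)))"
| Ax9: "bI_axiom ((\<alpha> \<^bold>\<rightarrow> \<beta>) \<^bold>\<or> \<alpha>)"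
| Ip: "bI_axiom ((\<alpha> \<^bold>\<up> \<beta>) \<^bold>\<rightarrow> (\<alpha> \<^bold>\<rightarrow> (\<beta> \<^bold>\<rightarrow> \<gamma>)))"
| Comm: "bI_axiom ((\<alpha> \<^bold>\<up> \<beta>) \<^bold>\<rightarrow> (\<beta> \<^bold>\<up> \<alpha>))"

definition bI_derivation :: "'v form set \<Rightarrow> 'v form list \<Rightarrow> bool" where
  "bI_derivation \<Gamma> \<phi>s \<longleftrightarrow>
     (\<forall>i<length \<phi>s. \<phi>s ! i \<in> \<Gamma> \<or> bI_axiom (\<phi>s ! i) \<or>
        (\<exists>j<i. \<exists>k<i. \<phi>s ! k = \<phi>s ! j \<^bold>\<rightarrow> \<phi>s ! i))"

definition bI_derivable :: "'v form set \<Rightarrow> 'v form \<Rightarrow> bool"  (infix "\<turnstile>bI" 50) where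
  "\<Gamma> \<turnstile>bI \<phi> \<longleftrightarrow> (\<exists>\<phi>s. bI_derivation \<Gamma> \<phi>s \<and> \<phi>s \<noteq> [] \<and> last \<phi>s = \<phi>)"


section \<open>Multialgebras and valuations\<close>

text \<open>The universe is an explicit set, so that every subset of a type may serve as a universe.
  The values of the interpretation outside the universe are irrelevant.\<close>

record 'a multialg =
  univ :: "'a set"
  interp :: "conn \<Rightarrow> 'a \<Rightarrow> 'a \<Rightarrow> 'a set"

definition multialgebra :: "'a multialg \<Rightarrow> bool" where
  "multialgebra \<A> \<longleftrightarrow> univ \<A> \<noteq> {} \<and>
     (\<forall>c. \<forall>a\<in>univ \<A>. \<forall>b\<in>univ \<A>. interp \<A> c a b \<noteq> {} \<and> interp \<A> c a b \<subseteq> univ \<A>)"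

definition ordinary_operation :: "'a multialg \<Rightarrow> conn \<Rightarrow> bool" where
  "ordinary_operation \<A> c \<longleftrightarrow> (\<forall>a\<in>univ \<A>. \<forall>b\<in>univ \<A>. is_singleton (interp \<A> c a b))"

text \<open>Meaningful only if \<open>c\<close> is interpreted by an ordinary operation.\<close>

definition operation :: "'a multialg \<Rightarrow> conn \<Rightarrow> 'a \<Rightarrow> 'a \<Rightarrow> 'a" where
  "operation \<A> c a b = the_elem (interp \<A> c a b)"

definition valuation :: "'a multialg \<Rightarrow> ('v form \<Rightarrow> 'a) \<Rightarrow> bool" where
  "valuation \<A> \<nu> \<longleftrightarrow> (\<forall>\<phi>. \<nu> \<phi> \<in> univ \<A>) \<and>
     (\<forall>c \<alpha> \<beta>. \<nu> (App c \<alpha> \<beta>) \<in> interp \<A> c (\<nu> \<alpha>) (\<nu> \<beta>))"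


section \<open>Boolean algebras on a carrier set\<close>

text \<open>The postulates of the library locale \<^locale>\<open>abstract_boolean_algebra\<close>, relativised
  to a carrier set.\<close>

locale carrier_boolean_algebra =
  fixes A :: "'a set"
    and conj :: "'a \<Rightarrow> 'a \<Rightarrow> 'a"
    and disj :: "'a \<Rightarrow> 'a \<Rightarrow> 'a"
    and compl :: "'a \<Rightarrow> 'a"
    and zero :: 'a
    and one :: 'a
  assumes conj_closed: "\<lbrakk>x \<in> A; y \<in> A\<rbrakk> \<Longrightarrow> conj x y \<in> A"
    and disj_closed: "\<lbrakk>x \<in> A; y \<in> A\<rbrakk> \<Longrightarrow> disj x y \<in> A"
    and compl_closed: "x \<in> A \<Longrightarrow> compl x \<in> A"
    and zero_closed: "zero \<in> A"
    and one_closed: "one \<in> A"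
    and conj_assoc: "\<lbrakk>x \<in> A; y \<in> A; z \<in> A\<rbrakk> \<Longrightarrow> conj (conj x y) z = conj x (conj y z)"
    and conj_commute: "\<lbrakk>x \<in> A; y \<in> A\<rbrakk> \<Longrightarrow> conj x y = conj y x"
    and disj_assoc: "\<lbrakk>x \<in> A; y \<in> A; z \<in> A\<rbrakk> \<Longrightarrow> disj (disj x y) z = disj x (disj y z)"
    and disj_commute: "\<lbrakk>x \<in> A; y \<in> A\<rbrakk> \<Longrightarrow> disj x y = disj y x"
    and conj_disj_distrib:
      "\<lbrakk>x \<in> A; y \<in> A; z \<in> A\<rbrakk> \<Longrightarrow> conj x (disj y z) = disj (conj x y) (conj x z)"
    and disj_conj_distrib:
      "\<lbrakk>x \<in> A; y \<in> A; z \<in> A\<rbrakk> \<Longrightarrow> disj x (conj y z) = conj (disj x y) (disj x z)"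
    and conj_one_right: "x \<in> A \<Longrightarrow> conj x one = x"
    and disj_zero_right: "x \<in> A \<Longrightarrow> disj x zero = x"
    and conj_cancel_right: "x \<in> A \<Longrightarrow> conj x (compl x) = zero"
    and disj_cancel_right: "x \<in> A \<Longrightarrow> disj x (compl x) = one"


section \<open>RNmatrices for bI and their consequence relation\<close>

text \<open>Bottom, top and complement are not part of the signature; they are uniquely determined
  on the universe by conjunction and disjunction.\<close>

definition bI_multialgebra :: "'a multialg \<Rightarrow> 'a \<Rightarrow> 'a \<Rightarrow> bool" where
  "bI_multialgebra \<A> zero one \<longleftrightarrow>
     multialgebra \<A> \<and>
     ordinary_operation \<A> And \<and> ordinary_operation \<A> Or \<and> ordinary_operation \<A> Imp \<and>
     (\<exists>compl.
        carrier_boolean_algebra (univ \<A>) (operation \<A> And) (operation \<A> Or) compl zero one \<and>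
        (\<forall>a\<in>univ \<A>. \<forall>b\<in>univ \<A>. operation \<A> Imp a b = operation \<A> Or (compl a) b)) \<and>
     (\<forall>a\<in>univ \<A>. \<forall>b\<in>univ \<A>. interp \<A> Up a b = interp \<A> Up b a) \<and>
     (\<forall>a\<in>univ \<A>. \<forall>b\<in>univ \<A>. \<forall>c\<in>univ \<A>.
        c \<in> interp \<A> Up a b \<longrightarrow> operation \<A> And (operation \<A> And a b) c = zero)"

definition bI_RNmatrix :: "'a multialg \<Rightarrow> 'a set \<Rightarrow> ('v form \<Rightarrow> 'a) set \<Rightarrow> bool" where
  "bI_RNmatrix \<A> D F \<longleftrightarrow>
     (\<exists>zero one. bI_multialgebra \<A> zero one \<and> zero \<noteq> one \<and> D = {one}) \<and>
     F = {\<nu>. valuation \<A> \<nu> \<and> (\<forall>\<alpha> \<beta>. \<nu> (\<alpha> \<^bold>\<up> \<beta>) = \<nu> (\<beta> \<^bold>\<up> \<alpha>))}"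

text \<open>HOL cannot quantify over types inside a definition. The consequence relation is therefore
  indexed by the type from which universes are drawn; the relation over all RNmatrices is
  obtained by leaving that type arbitrary.\<close>

definition bI_consequence :: "'a itself \<Rightarrow> 'v form set \<Rightarrow> 'v form \<Rightarrow> bool" where
  "bI_consequence _ \<Gamma> \<phi> \<longleftrightarrow>
     (\<forall>(\<A> :: 'a multialg) D F. bI_RNmatrix \<A> D F \<longrightarrow>
        (\<forall>\<nu>\<in>F. (\<forall>\<gamma>\<in>\<Gamma>. \<nu> \<gamma> \<in> D) \<longrightarrow> \<nu> \<phi> \<in> D))"

end

theory Submission
  imports Defs
begin

text \<open>
  Soundness holds because the formulas that an admitted valuation sends to the top element include
  every axiom and are closed under Modus Ponens. In a Boolean algebra an implication has
  value \<open>1\<close> exactly if its antecedent lies below its consequent, and \<open>\<rightarrow>\<close> is the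
  right adjoint of \<open>\<and>\<close>: \<open>z \<le> x \<rightarrow> y\<close> iff \<open>z \<and> x \<le> y\<close> (lemma \<open>le_imp_iff\<close>).
  By adjunction the antecedents of an axiom collect into one meet, which has to lie below the final
  consequent.
  The axiom \<open>Ax9\<close> is classical and is computed with complements: \<open>(\<alpha> \<rightarrow> \<beta>) \<or> \<alpha>\<close> evaluates to
  \<open>\<not>a \<or> b \<or> a\<close>, where \<open>a\<close> and \<open>b\<close> are the values of \<open>\<alpha>\<close> and \<open>\<beta>\<close>.

  The two axioms for \<open>\<up>\<close> are where the nondeterministic part enters. \<open>Ip\<close> says
  \<open>(\<alpha> \<up> \<beta>) \<and> \<alpha> \<and> \<beta> \<le> \<gamma>\<close>, which holds since every value
  in \<open>a \<up> b\<close> has meet \<open>0\<close> with \<open>a \<and> b\<close>. For \<open>Comm\<close>, equality of the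
  sets \<open>a \<up> b\<close> and \<open>b \<up> a\<close> would be too weak, because a valuation could choose
  different members for \<open>\<alpha> \<up> \<beta>\<close> and \<open>\<beta> \<up> \<alpha>\<close>; it is the restriction
  on the admitted valuations that excludes this.
\<close>

section \<open>Order and implication in a Boolean algebra on a carrier\<close>

context carrier_boolean_algebra
begin

text \<open>Membership of both arguments is part of the order, so that transitivity and
  the use of inequalities between values need no separate closure conditions.\<close>

definition le :: "'a \<Rightarrow> 'a \<Rightarrow> bool" where
  "le x y \<longleftrightarrow> x \<in> A \<and> y \<in> A \<and> conj x y = x"

definition imp :: "'a \<Rightarrow> 'a \<Rightarrow> 'a" where
  "imp x y = disj (compl x) y"

lemma imp_closed: "\<lbrakk>x \<in> A; y \<in> A\<rbrakk> \<Longrightarrow> imp x y \<in> A"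
  by (simp add: imp_def disj_closed compl_closed)

lemmas closed = conj_closed disj_closed compl_closed zero_closed one_closed imp_closed

lemma conj_idem: assumes "x \<in> A" shows "conj x x = x"
proof -
  have "conj x x = disj (conj x x) (conj x (compl x))"
    by (simp add: assms closed conj_cancel_right disj_zero_right)
  also have "\<dots> = conj x (disj x (compl x))"
    by (simp add: assms closed conj_disj_distrib)
  also have "\<dots> = x"
    by (simp add: assms disj_cancel_right conj_one_right)
  finally show ?thesis .
qed

lemma disj_idem: assumes "x \<in> A" shows "disj x x = x"
proof -
  have "disj x x = conj (disj x x) (disj x (compl x))"
    by (simp add: assms closed disj_cancel_right conj_one_right)
  also have "\<dots> = disj x (conj x (compl x))"
    by (simp add: assms closed disj_conj_distrib)
  also have "\<dots> = x"
    by (simp add: assms conj_cancel_right disj_zero_right)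
  finally show ?thesis .
qed

lemma conj_zero_right: assumes "x \<in> A" shows "conj x zero = zero"
proof -
  have "conj x (conj x (compl x)) = conj x (compl x)"
    by (simp only: conj_assoc[symmetric] conj_idem assms closed)
  then show ?thesis by (simp add: assms conj_cancel_right)
qed

lemma disj_one_right: assumes "x \<in> A" shows "disj x one = one"
proof -
  have "disj x (disj x (compl x)) = disj x (compl x)"
    by (simp only: disj_assoc[symmetric] disj_idem assms closed)
  then show ?thesis by (simp add: assms disj_cancel_right)
qed

lemma conj_disj_absorb:
  assumes "x \<in> A" "y \<in> A" shows "conj x (disj x y) = x"
proof -
  have "conj x (disj x y) = conj (disj x zero) (disj x y)"
    by (simp add: assms disj_zero_right)
  also have "\<dots> = disj x (conj y zero)"
    by (simp add: assms closed disj_conj_distrib conj_commute[of y zero])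
  also have "\<dots> = x"
    by (simp add: assms conj_zero_right disj_zero_right)
  finally show ?thesis .
qed

lemma le_refl: "x \<in> A \<Longrightarrow> le x x"
  by (simp add: le_def conj_idem)

lemma le_trans: "\<lbrakk>le x y; le y z\<rbrakk> \<Longrightarrow> le x z"
  unfolding le_def using conj_assoc[of x y z] by simp

lemma zero_le: "x \<in> A \<Longrightarrow> le zero x"
  by (simp add: le_def closed conj_commute[of zero] conj_zero_right)

lemma conj_le1: assumes "x \<in> A" "y \<in> A" shows "le (conj x y) x"
  unfolding le_def
  by (simp add: assms closed conj_commute[of x y] conj_assoc conj_idem)

lemma conj_le2: assumes "x \<in> A" "y \<in> A" shows "le (conj x y) y"
  by (simp add: assms conj_commute[of x y] conj_le1)

lemma le_conjI: assumes "le z x" "le z y" shows "le z (conj x y)"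
  using assms conj_assoc[of z x y] by (simp add: le_def closed)

lemma le_disj1: "\<lbrakk>x \<in> A; y \<in> A\<rbrakk> \<Longrightarrow> le x (disj x y)"
  by (simp add: le_def closed conj_disj_absorb)

lemma le_disj2: "\<lbrakk>x \<in> A; y \<in> A\<rbrakk> \<Longrightarrow> le y (disj x y)"
  by (simp add: disj_commute[of x y] le_disj1)

lemma disj_leI: assumes "le x z" "le y z" shows "le (disj x y) z"
proof -
  have "conj z x = x" "conj z y = y"
    using assms by (simp_all add: le_def conj_commute[of z])
  then show ?thesis
    using assms by (simp add: le_def closed conj_commute[of "disj x y"] conj_disj_distrib)
qed

text \<open>One direction splits \<open>z\<close> as \<open>(z \<and> x) \<or> (z \<and> \<not>x)\<close>; the other distributes
  \<open>x\<close> over \<open>\<not>x \<or> y\<close>.\<close>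

lemma le_imp_iff:
  assumes "x \<in> A" "y \<in> A" "z \<in> A"
  shows "le z (imp x y) \<longleftrightarrow> le (conj z x) y"
proof
  assume *: "le (conj z x) y"
  have "z = disj (conj z x) (conj z (compl x))"
    by (simp add: assms closed conj_disj_distrib[symmetric] disj_cancel_right conj_one_right)
  moreover have "le (conj z x) (imp x y)"
    unfolding imp_def by (rule le_trans[OF *]) (simp add: assms closed le_disj2)
  moreover have "le (conj z (compl x)) (imp x y)"
    unfolding imp_def by (rule le_trans[OF conj_le2 le_disj1]) (simp_all add: assms closed)
  ultimately show "le z (imp x y)"
    using disj_leI by metis
next
  assume *: "le z (imp x y)"
  have "conj x (imp x y) = disj zero (conj x y)"
    unfolding imp_def by (simp add: assms closed conj_disj_distrib conj_cancel_right)
  also have "\<dots> = conj x y"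
    by (simp add: assms closed disj_commute[of zero] disj_zero_right)
  finally have eq: "conj x (imp x y) = conj x y" .
  have "le (conj z x) (conj x (imp x y))"
    by (rule le_conjI[OF conj_le2 le_trans[OF conj_le1 *]]) (simp_all add: assms)
  then have "le (conj z x) (conj x y)"
    by (simp only: eq)
  then show "le (conj z x) y"
    by (rule le_trans[OF _ conj_le2]) (simp_all add: assms)
qed

lemma imp_eq_one_iff:
  assumes "x \<in> A" "y \<in> A"
  shows "imp x y = one \<longleftrightarrow> le x y"
proof -
  have "imp x y = one \<longleftrightarrow> le one (imp x y)"
    by (simp add: le_def assms closed conj_commute[of one] conj_one_right)
  also have "\<dots> \<longleftrightarrow> le x y"
    by (simp add: assms closed le_imp_iff conj_commute[of one] conj_one_right)
  finally show ?thesis .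
qed

lemma modus_ponens_le:
  assumes "le z (imp x y)" "le z x" "y \<in> A"
  shows "le z y"
proof -
  have mem: "x \<in> A" "z \<in> A" using assms(2) by (simp_all add: le_def)
  then have "le (conj z x) y"
    using assms(1,3) by (simp add: le_imp_iff)
  moreover have "conj z x = z"
    using assms(2) by (simp add: le_def)
  ultimately show ?thesis by simp
qed

text \<open>The axioms \<open>Ax2\<close> and \<open>Ax8\<close>, in the form they take once the adjunction has moved every
  antecedent to the left.\<close>

lemma imp_distrib_le:
  assumes "a \<in> A" "b \<in> A" "c \<in> A"
  shows "le (conj (conj (imp a (imp b c)) (imp a b)) a) c"
proof -
  let ?p = "imp a (imp b c)" and ?q = "imp a b"
  let ?z = "conj (conj ?p ?q) a"
  have pq: "le ?z (conj ?p ?q)" and a: "le ?z a"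
    by (simp_all add: assms closed conj_le1 conj_le2)
  have p: "le ?z ?p" and q: "le ?z ?q"
    by (rule le_trans[OF pq conj_le1] le_trans[OF pq conj_le2]; simp add: assms closed)+
  have "le ?z (imp b c)"
    using p a by (rule modus_ponens_le) (simp add: assms closed)
  moreover have "le ?z b"
    using q a assms(2) by (rule modus_ponens_le)
  ultimately show ?thesis
    using assms(3) by (rule modus_ponens_le)
qed

lemma case_distinction_le:
  assumes "a \<in> A" "b \<in> A" "c \<in> A"
  shows "le (conj (conj (imp a c) (imp b c)) (disj a b)) c"
proof -
  let ?z = "conj (imp a c) (imp b c)"
  have z: "?z \<in> A" "le ?z (imp a c)" "le ?z (imp b c)"
    using assms by (simp_all add: closed conj_le1 conj_le2)
  \<comment> \<open>Adjunction is used in both directions: for a fixed \<open>z\<close>, the elements whose meet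
    with \<open>z\<close> lies below \<open>c\<close> are those below \<open>z \<rightarrow> c\<close>, hence closed under joins.\<close>
  have "le a (imp ?z c)" "le b (imp ?z c)"
    using z assms by (simp_all add: le_imp_iff closed conj_commute[of _ ?z])
  then have "le (disj a b) (imp ?z c)"
    by (rule disj_leI)
  then show ?thesis
    using z(1) assms by (simp add: le_imp_iff closed conj_commute[of _ ?z])
qed

lemma imp_disj_antecedent:
  assumes "a \<in> A" "b \<in> A"
  shows "disj (imp a b) a = one"
proof -
  have "disj (imp a b) a = disj b (disj a (compl a))"
    unfolding imp_def
    by (simp add: assms closed disj_commute[of "compl a"] disj_assoc)
  then show ?thesis
    by (simp add: assms disj_cancel_right disj_one_right)
qed

end

section \<open>Values of axioms and derivations under an admitted valuation\<close>

text \<open>What an admitted valuation does, freed of the set-valued interpretation: on \<open>\<and>\<close>, \<open>\<or>\<close> and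
  \<open>\<rightarrow>\<close> it is a homomorphism, and all that the axioms for \<open>\<up>\<close> see of its choices is
  the last two assumptions.\<close>

locale bI_valuation = carrier_boolean_algebra A conj disj compl zero one
  for A :: "'a set" and conj disj compl zero one +
  fixes \<nu> :: "'v form \<Rightarrow> 'a"
  assumes in_univ: "\<nu> \<alpha> \<in> A"
    and val_And: "\<nu> (\<alpha> \<^bold>\<and> \<beta>) = conj (\<nu> \<alpha>) (\<nu> \<beta>)"
    and val_Or: "\<nu> (\<alpha> \<^bold>\<or> \<beta>) = disj (\<nu> \<alpha>) (\<nu> \<beta>)"
    and val_Imp: "\<nu> (\<alpha> \<^bold>\<rightarrow> \<beta>) = imp (\<nu> \<alpha>) (\<nu> \<beta>)"
    and val_Up_incompatible: "conj (conj (\<nu> \<alpha>) (\<nu> \<beta>)) (\<nu> (\<alpha> \<^bold>\<up> \<beta>)) = zero"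
    and val_Up_commute: "\<nu> (\<alpha> \<^bold>\<up> \<beta>) = \<nu> (\<beta> \<^bold>\<up> \<alpha>)"
begin

lemma axiom_eq_one:
  assumes "bI_axiom \<phi>"
  shows "\<nu> \<phi> = one"
  using assms
proof cases
  case (Ip \<alpha> \<beta> \<gamma>)
  have "conj (conj (\<nu> (\<alpha> \<^bold>\<up> \<beta>)) (\<nu> \<alpha>)) (\<nu> \<beta>) = zero"
    using val_Up_incompatible[of \<alpha> \<beta>]
    by (simp add: in_univ closed conj_assoc conj_commute[of _ "\<nu> (\<alpha> \<^bold>\<up> \<beta>)"])
  then show ?thesis
    unfolding Ip by (simp add: val_Imp in_univ closed imp_eq_one_iff le_imp_iff zero_le)
next
  case (Comm \<alpha> \<beta>)
  have "le (\<nu> (\<alpha> \<^bold>\<up> \<beta>)) (\<nu> (\<beta> \<^bold>\<up> \<alpha>))"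
    unfolding val_Up_commute[of \<alpha> \<beta>] by (rule le_refl[OF in_univ])
  then show ?thesis
    unfolding Comm by (simp add: val_Imp in_univ imp_eq_one_iff)
qed (simp_all add: val_And val_Or val_Imp in_univ closed imp_eq_one_iff imp_distrib_le
      case_distinction_le imp_disj_antecedent le_disj1 le_disj2 conj_le1 conj_le2 le_imp_iff
      le_refl)

lemma modus_ponens_eq_one:
  assumes "\<nu> (\<alpha> \<^bold>\<rightarrow> \<beta>) = one" "\<nu> \<alpha> = one"
  shows "\<nu> \<beta> = one"
proof -
  have "le one (\<nu> \<beta>)"
    using assms by (simp add: val_Imp imp_eq_one_iff in_univ closed)
  then show ?thesis
    by (simp add: le_def in_univ closed conj_commute[of one] conj_one_right)
qed

lemma derivation_eq_one:
  assumes "bI_derivation \<Gamma> \<phi>s" and prem: "\<And>\<gamma>. \<gamma> \<in> \<Gamma> \<Longrightarrow> \<nu> \<gamma> = one"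
    and "i < length \<phi>s"
  shows "\<nu> (\<phi>s ! i) = one"
  using assms(3)
proof (induction i rule: less_induct)
  case (less i)
  then consider "\<phi>s ! i \<in> \<Gamma>" | "bI_axiom (\<phi>s ! i)"
    | j k where "j < i" "k < i" "\<phi>s ! k = \<phi>s ! j \<^bold>\<rightarrow> \<phi>s ! i"
    using assms(1) unfolding bI_derivation_def by blast
  then show ?case
  proof cases
    case 1
    then show ?thesis by (rule prem)
  next
    case 2
    then show ?thesis by (rule axiom_eq_one)
  next
    case 3
    then have "\<nu> (\<phi>s ! j) = one" "\<nu> (\<phi>s ! j \<^bold>\<rightarrow> \<phi>s ! i) = one"
      using less.IH[of j] less.IH[of k] less.prems by simp_all
    then show ?thesis
      using modus_ponens_eq_one by blast
  qed
qed

end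

section \<open>Soundness for RNmatrices\<close>

lemma valuation_ordinary_operation:
  assumes "valuation \<A> \<nu>" "ordinary_operation \<A> c"
  shows "\<nu> (App c \<alpha> \<beta>) = operation \<A> c (\<nu> \<alpha>) (\<nu> \<beta>)"
proof -
  have "is_singleton (interp \<A> c (\<nu> \<alpha>) (\<nu> \<beta>))"
    and "\<nu> (App c \<alpha> \<beta>) \<in> interp \<A> c (\<nu> \<alpha>) (\<nu> \<beta>)"
    using assms unfolding valuation_def ordinary_operation_def by blast+
  then show ?thesis
    unfolding operation_def by (auto elim!: is_singletonE)
qed

lemma RNmatrix_bI_valuation:
  assumes "bI_RNmatrix \<A> D F" "\<nu> \<in> F"
  obtains compl zero one where "D = {one}"
    "bI_valuation (univ \<A>) (operation \<A> And) (operation \<A> Or) compl zero one \<nu>"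
proof -
  from assms(1) obtain zero one where M: "bI_multialgebra \<A> zero one" and D: "D = {one}"
    unfolding bI_RNmatrix_def by blast
  from M obtain compl where
    B: "carrier_boolean_algebra (univ \<A>) (operation \<A> And) (operation \<A> Or) compl zero one"
    and I: "\<forall>a\<in>univ \<A>. \<forall>b\<in>univ \<A>. operation \<A> Imp a b = operation \<A> Or (compl a) b"
    unfolding bI_multialgebra_def by blast
  from M have ord: "ordinary_operation \<A> And" "ordinary_operation \<A> Or" "ordinary_operation \<A> Imp"
    and Up: "\<forall>a\<in>univ \<A>. \<forall>b\<in>univ \<A>. \<forall>c\<in>univ \<A>.
        c \<in> interp \<A> Up a b \<longrightarrow> operation \<A> And (operation \<A> And a b) c = zero"
    unfolding bI_multialgebra_def by blast+
  from assms have val: "valuation \<A> \<nu>" and comm: "\<And>\<alpha> \<beta>. \<nu> (\<alpha> \<^bold>\<up> \<beta>) = \<nu> (\<beta> \<^bold>\<up> \<alpha>)"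
    unfolding bI_RNmatrix_def by blast+
  then have mem: "\<And>\<alpha>. \<nu> \<alpha> \<in> univ \<A>"
    and step: "\<And>c \<alpha> \<beta>. \<nu> (App c \<alpha> \<beta>) \<in> interp \<A> c (\<nu> \<alpha>) (\<nu> \<beta>)"
    unfolding valuation_def by blast+
  interpret carrier_boolean_algebra "univ \<A>" "operation \<A> And" "operation \<A> Or" compl zero one
    by (rule B)
  have "bI_valuation (univ \<A>) (operation \<A> And) (operation \<A> Or) compl zero one \<nu>"
  proof unfold_locales
    show "\<nu> (\<alpha> \<^bold>\<rightarrow> \<beta>) = imp (\<nu> \<alpha>) (\<nu> \<beta>)" for \<alpha> \<beta>
      using valuation_ordinary_operation[OF val ord(3)] I mem by (simp add: imp_def)
    show "\<nu> (\<alpha> \<^bold>\<and> \<beta>) = operation \<A> And (\<nu> \<alpha>) (\<nu> \<beta>)"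
      and "\<nu> (\<alpha> \<^bold>\<or> \<beta>) = operation \<A> Or (\<nu> \<alpha>) (\<nu> \<beta>)" for \<alpha> \<beta>
      using ord by (simp_all add: valuation_ordinary_operation[OF val])
    show "operation \<A> And (operation \<A> And (\<nu> \<alpha>) (\<nu> \<beta>)) (\<nu> (\<alpha> \<^bold>\<up> \<beta>)) = zero" for \<alpha> \<beta>
      using Up mem step by blast
  qed (rule mem comm)+
  with D show thesis by (rule that)
qed

theorem theorem2:
  fixes \<Gamma> :: "'v::countable form set" and \<phi> :: "'v form"
  assumes "\<Gamma> \<turnstile>bI \<phi>"
  shows "bI_consequence TYPE('a) \<Gamma> \<phi>"
  unfolding bI_consequence_def
proof (intro allI impI ballI)
  fix \<A> :: "'a multialg" and D F and \<nu> :: "'v form \<Rightarrow> 'a"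
  assume "bI_RNmatrix \<A> D F" "\<nu> \<in> F" and prem: "\<forall>\<gamma>\<in>\<Gamma>. \<nu> \<gamma> \<in> D"
  from RNmatrix_bI_valuation[OF this(1,2)] obtain compl zero one where D: "D = {one}"
    and "bI_valuation (univ \<A>) (operation \<A> And) (operation \<A> Or) compl zero one \<nu>" .
  then interpret bI_valuation "univ \<A>" "operation \<A> And" "operation \<A> Or" compl zero one \<nu>
    by simp
  from assms obtain \<phi>s where der: "bI_derivation \<Gamma> \<phi>s" and "\<phi>s \<noteq> []" "last \<phi>s = \<phi>"
    unfolding bI_derivable_def by blast
  then have last: "\<phi> = \<phi>s ! (length \<phi>s - 1)" "length \<phi>s - 1 < length \<phi>s"
    by (simp_all add: last_conv_nth)
  have "\<nu> \<phi> = one"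
    unfolding last(1) by (rule derivation_eq_one[OF der _ last(2)]) (use prem D in blast)
  then show "\<nu> \<phi> \<in> D"
    by (simp add: D)
qed

end
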